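(* Let $(\gamma,c)$ and $(\gamma',c')$ be colored trivalent graphs related via elementary transformations or changes of the coloring by the boundary of a $1$-chain in $\mathrm{C}_1(\gamma,\mathbb{F}_2)$. Then their periods agree: $$\pi_{\widetilde W_{\gamma,c}}(t)=\pi_{\widetilde W_{\gamma',c'}}(t),$$ and moreover they are independent of the choice of ambient lattice: $\pi_{\widetilde W_{\gamma,c}}(t)=\pi_{W_{\gamma,c}}(t)$.
   Context: A trivalent graph $\gamma=(V,E)$ is a finite connected undirected graph (loops and multiple edges allowed) in which every vertex is incident to exactly three half-edges. A coloring is a function $c\colon V\to\mathbb{F}_2$, viewed as a $0$-chain; the boundary of the $1$-chain $[e]$ of an edge $e$ joining $v,v'$ is $[v]+[v']$. With a variable $x_e$ for each edge, the vertex potential at $v$, whose half-edges belong to edges with variables $x_i,x_j,x_k$ (a loop contributes its variable twice), is $\widetilde W_{v,c}=\sum_{s_i+s_j+s_k=c(v)}x_i^{(-1)^{s_i}}x_j^{(-1)^{s_j}}x_k^{(-1)^{s_k}}$ (sum over $(s_i,s_j,s_k)\in\mathbb{F}_2^3$), and the graph potential is $\widetilde W_{\gamma,c}=\sum_{v\in V}\widetilde W_{v,c}$. Lattices: $\widetilde N_\gamma=\mathrm{C}^1(\gamma,\mathbb{Z})\cong\mathbb{Z}^E$ is the exponent lattice of Laurent monomials in the $x_e$; $N_\gamma\subseteq\widetilde N_\gamma$ is the sublattice generated, over all vertices $v$, by the exponents $\pm x_i\pm x_j\pm x_k$ of the three half-edges at $v$. The graph potential lies in $\mathbb{Z}[N_\gamma]\subseteq\mathbb{Z}[\widetilde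 N_\gamma]$; regarded as an element of $\mathbb{Z}[N_\gamma]$, i.e. as a Laurent polynomial with respect to a basis of $N_\gamma$, it is denoted $W_{\gamma,c}$. The period of a Laurent polynomial $W$ in $n$ variables is $\pi_W(t)=\left(\frac{1}{2\pi\sqrt{-1}}\right)^n\int_{|x_1|=\dots=|x_n|=1}\frac{1}{1-tW}\frac{\mathrm{d}x_1}{x_1}\cdots\frac{\mathrm{d}x_n}{x_n}=\sum_{k\ge0}[W^k]_0t^k$ ($|t|$ small), where $[\cdot]_0$ is the constant term. Elementary transformation: let $e$ be a non-loop edge joining distinct vertices $v_1,v_2$; let $h_a,h_b$ be the two other half-edges at $v_1$ and $h_c,h_d$ those at $v_2$ (some may belong to the same edge). The transformed graph has the same vertices and edges, but $v_1$ is incident to $e,h_a,h_c$ and $v_2$ to $e,h_b,h_d$; everything else, including the color of every vertex, is unchanged. *)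

theory Defs
  imports
    "HOL-Analysis.Analysis"
    "HOL-Library.Multiset"
    "HOL-Library.Poly_Mapping"
    "HOL-Library.Z2"
    "HOL-Computational_Algebra.Formal_Power_Series"
begin

section \<open>Colored trivalent graphs\<close>

text \<open>Loops and multiple edges are allowed: an edge has a two-element multiset of endpoints, which is
  \<open>{#v, v#}\<close> for a loop at \<open>v\<close>.\<close>

record ('v, 'e) multigraph =
  verts :: "'v set"
  edges :: "'e set"
  ends :: "'e \<Rightarrow> 'v multiset"

text \<open>The half-edges at \<open>v\<close>, each represented by the edge it belongs to; a loop occurs twice.\<close>

definition half_edges_at :: "('v, 'e) multigraph \<Rightarrow> 'v \<Rightarrow> 'e multiset" where
  "half_edges_at \<gamma> v = (\<Sum>e\<in>edges \<gamma>. replicate_mset (count (ends \<gamma> e) v) e)"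

definition adjacent :: "('v, 'e) multigraph \<Rightarrow> 'v \<Rightarrow> 'v \<Rightarrow> bool" where
  "adjacent \<gamma> v w \<longleftrightarrow> (\<exists>e\<in>edges \<gamma>. ends \<gamma> e = {#v, w#})"

definition trivalent_graph :: "('v, 'e) multigraph \<Rightarrow> bool" where
  "trivalent_graph \<gamma> \<longleftrightarrow>
     finite (verts \<gamma>) \<and> finite (edges \<gamma>) \<and>
     (\<forall>e\<in>edges \<gamma>. size (ends \<gamma> e) = 2 \<and> set_mset (ends \<gamma> e) \<subseteq> verts \<gamma>) \<and>
     verts \<gamma> \<noteq> {} \<and> (\<forall>v\<in>verts \<gamma>. \<forall>w\<in>verts \<gamma>. (adjacent \<gamma>)\<^sup>*\<^sup>* v w) \<and>
     (\<forall>v\<in>verts \<gamma>. size (half_edges_at \<gamma> v) = 3)"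

text \<open>The type \<^typ>\<open>bit\<close> is the field with two elements. Colorings are functions
  \<^typ>\<open>'v \<Rightarrow> bit\<close> of which only the values on the vertices matter.\<close>

type_synonym ('v, 'e) colored_graph = "('v, 'e) multigraph \<times> ('v \<Rightarrow> bit)"

text \<open>In the following definition \<open>a\<close>, \<open>b\<close>, \<open>c\<close>, \<open>d\<close> are the edges containing the other
  half-edges at \<open>v1\<close> and at \<open>v2\<close>; they need not be distinct. The conditions on the half-edges
  determine the endpoints of all edges of \<open>\<gamma>'\<close>.\<close>

definition elementary_transformation ::
    "('v, 'e) colored_graph \<Rightarrow> ('v, 'e) colored_graph \<Rightarrow> bool" where
  "elementary_transformation = (\<lambda>(\<gamma>, col) (\<gamma>', col').
     trivalent_graph \<gamma> \<and> trivalent_graph \<gamma>' \<and>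
     verts \<gamma>' = verts \<gamma> \<and> edges \<gamma>' = edges \<gamma> \<and> (\<forall>v\<in>verts \<gamma>. col' v = col v) \<and>
     (\<exists>e\<in>edges \<gamma>. \<exists>v1\<in>verts \<gamma>. \<exists>v2\<in>verts \<gamma>. \<exists>a b c d.
        v1 \<noteq> v2 \<and> ends \<gamma> e = {#v1, v2#} \<and>
        half_edges_at \<gamma> v1 = {#e, a, b#} \<and> half_edges_at \<gamma> v2 = {#e, c, d#} \<and>
        half_edges_at \<gamma>' v1 = {#e, a, c#} \<and> half_edges_at \<gamma>' v2 = {#e, b, d#} \<and>
        (\<forall>v\<in>verts \<gamma> - {v1, v2}. half_edges_at \<gamma>' v = half_edges_at \<gamma> v)))"

text \<open>The coefficient at \<open>v\<close> of the boundary of the 1-chain \<open>\<Sum>e. z e [e]\<close>. A loop has boundary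
  \<open>[v] + [v] = 0\<close>.\<close>

definition chain_boundary :: "('v, 'e) multigraph \<Rightarrow> ('e \<Rightarrow> bit) \<Rightarrow> 'v \<Rightarrow> bit" where
  "chain_boundary \<gamma> z v = (\<Sum>e\<in>edges \<gamma>. z e * of_nat (count (ends \<gamma> e) v))"

definition boundary_change ::
    "('v, 'e) colored_graph \<Rightarrow> ('v, 'e) colored_graph \<Rightarrow> bool" where
  "boundary_change = (\<lambda>(\<gamma>, col) (\<gamma>', col').
     trivalent_graph \<gamma> \<and> \<gamma>' = \<gamma> \<and>
     (\<exists>z. \<forall>v\<in>verts \<gamma>. col' v = col v + chain_boundary \<gamma> z v))"

definition related_colored_graphs ::
    "('v, 'e) colored_graph \<Rightarrow> ('v, 'e) colored_graph \<Rightarrow> bool" where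
  "related_colored_graphs = equivclp (\<lambda>G G'. elementary_transformation G G' \<or> boundary_change G G')"


section \<open>Laurent polynomials and periods\<close>

text \<open>The group ring of the free abelian group on \<^typ>\<open>'i\<close>, i.e. Laurent polynomials with
  integer coefficients in variables indexed by \<^typ>\<open>'i\<close>. The exponent of a monomial is a
  finitely supported function \<^typ>\<open>'i \<Rightarrow>\<^sub>0 int\<close>, and multiplication is convolution.\<close>

type_synonym 'i laurent = "('i \<Rightarrow>\<^sub>0 int) \<Rightarrow>\<^sub>0 int"

definition laurent_eval :: "'i laurent \<Rightarrow> ('i \<Rightarrow> complex) \<Rightarrow> complex" where
  "laurent_eval W x =
     (\<Sum>u\<in>Poly_Mapping.keys W.
        of_int (Poly_Mapping.lookup W u) *
        (\<Prod>i\<in>Poly_Mapping.keys u. x i powi Poly_Mapping.lookup u i))"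

text \<open>The period of a Laurent polynomial in the variables \<open>x i\<close>, \<open>i \<in> I\<close>. On the torus put
  \<open>x i = exp (\<i> \<theta> i)\<close>, so that \<open>dx/x = \<i> d\<theta>\<close> and the factor \<open>1 / (2 \<pi> \<i>)\<close> becomes
  \<open>1 / (2 \<pi>)\<close>. Only the germ at \<open>t = 0\<close> is meaningful.\<close>

definition period :: "'i set \<Rightarrow> 'i laurent \<Rightarrow> complex \<Rightarrow> complex" where
  "period I W t =
     (1 / (2 * of_real pi)) ^ card I *
     set_lebesgue_integral (\<Pi>\<^sub>M i\<in>I. lborel) (\<Pi>\<^sub>E i\<in>I. {0..2 * pi})
       (\<lambda>\<theta>. 1 / (1 - t * laurent_eval W (\<lambda>i. cis (\<theta> i))))"

text \<open>The expansion of the period at \<open>0\<close>: its coefficients are the constant terms of the powers of \<open>W\<close>.\<close>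

definition period_series :: "'i laurent \<Rightarrow> int fps" where
  "period_series W = Abs_fps (\<lambda>k. Poly_Mapping.lookup (W ^ k) 0)"


section \<open>Graph potentials\<close>

definition bit_sign :: "bit \<Rightarrow> int" where
  "bit_sign s = (if s = 0 then 1 else - 1)"

definition var_power :: "'e \<Rightarrow> int \<Rightarrow> 'e laurent" where
  "var_power i k = Poly_Mapping.single (frag_cmul k (frag_of i)) 1"

definition triple_potential :: "'e \<Rightarrow> 'e \<Rightarrow> 'e \<Rightarrow> bit \<Rightarrow> 'e laurent" where
  "triple_potential i j k \<epsilon> =
     (\<Sum>(si, sj, sk) | si + sj + sk = \<epsilon>.
        var_power i (bit_sign si) * var_power j (bit_sign sj) * var_power k (bit_sign sk))"

text \<open>The vertex potential; the expression above is symmetric in the three variables, so the choice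
  of an order of the half-edges is immaterial.\<close>

definition vertex_potential :: "('v, 'e) multigraph \<Rightarrow> ('v \<Rightarrow> bit) \<Rightarrow> 'v \<Rightarrow> 'e laurent" where
  "vertex_potential \<gamma> col v =
     (let (i, j, k) = (SOME (i, j, k). half_edges_at \<gamma> v = {#i, j, k#})
      in triple_potential i j k (col v))"

definition graph_potential :: "('v, 'e) multigraph \<Rightarrow> ('v \<Rightarrow> bit) \<Rightarrow> 'e laurent" where
  "graph_potential \<gamma> col = (\<Sum>v\<in>verts \<gamma>. vertex_potential \<gamma> col v)"


section \<open>The sublattice and the potential in lattice coordinates\<close>

global_interpretation lattice: module "frag_cmul :: int \<Rightarrow> ('i \<Rightarrow>\<^sub>0 int) \<Rightarrow> ('i \<Rightarrow>\<^sub>0 int)"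
  by unfold_locales (simp_all add: frag_cmul_distrib frag_cmul_distrib2)

definition potential_lattice :: "('v, 'e) multigraph \<Rightarrow> ('e \<Rightarrow>\<^sub>0 int) set" where
  "potential_lattice \<gamma> = lattice.span
     {frag_cmul p (frag_of i) + frag_cmul q (frag_of j) + frag_cmul r (frag_of k) | p q r i j k.
        p \<in> {1, -1} \<and> q \<in> {1, -1} \<and> r \<in> {1, -1} \<and>
        (\<exists>v\<in>verts \<gamma>. half_edges_at \<gamma> v = {#i, j, k#})}"

definition lattice_basis :: "('i \<Rightarrow>\<^sub>0 int) set \<Rightarrow> ('i \<Rightarrow>\<^sub>0 int) set \<Rightarrow> bool" where
  "lattice_basis B N \<longleftrightarrow> finite B \<and> \<not> lattice.dependent B \<and> lattice.span B = N"

text \<open>A Laurent polynomial whose exponents lie in the lattice with basis \<open>B\<close>, rewritten as a Laurent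
  polynomial with one variable for each element of \<open>B\<close>: every exponent is replaced by its vector of
  coordinates with respect to \<open>B\<close>.\<close>

definition in_basis :: "('i \<Rightarrow>\<^sub>0 int) set \<Rightarrow> 'i laurent \<Rightarrow> ('i \<Rightarrow>\<^sub>0 int) laurent" where
  "in_basis B W =
     (\<Sum>u\<in>Poly_Mapping.keys W.
        Poly_Mapping.single (Abs_poly_mapping (lattice.representation B u)) (Poly_Mapping.lookup W u))"

end

(* For small t the geometric series can be integrated termwise over the torus, and the integral of a
   nonconstant monomial vanishes; so a period is the power series of the constant terms [W^k]_0, and it
   suffices to compare these. Adding the boundary of a chain to the coloring amounts to inverting
   the variables of the edges in the chain, and passing to a basis of the sublattice is undone by an
   exponent map which is injective on the span of the basis; neither affects constant terms. For an
   elementary transformation at e write W = x_e P + x_e^(-1) Q + R with P, Q, R free of x_e. The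
   constant terms of the powers of W depend only on PQ and R; the transformation leaves R unchanged,
   and PQ as well by an identity that is symmetric in the two edges which are exchanged. *)

theory Submission
  imports Defs
begin

section \<open>Constant terms of Laurent polynomials\<close>


lemma cmul_frag_of: "frag_cmul c (frag_of x) = Poly_Mapping.single x c"
  by (rule poly_mapping_eqI) (simp add: lookup_single)

text \<open>Both sides are additive in \<open>P\<close> and in \<open>Q\<close>, so two inductions
  reduce the claim to a product of two monomials.\<close>

lemma frag_extend_mult:
  fixes f :: "'a::monoid_add \<Rightarrow> 'b::monoid_add \<Rightarrow>\<^sub>0 int"
  assumes "\<And>u v. f (u + v) = f u * f v"
  shows "frag_extend f (P * Q) = frag_extend f P * frag_extend f Q"
proof -
  have single: "frag_extend f (frag_of u * Q) = f u * frag_extend f Q" for u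
    using subset_UNIV
    by (induction Q rule: frag_induction) (auto simp: mult_single assms frag_extend_diff right_diff_distrib)
  show ?thesis
    using subset_UNIV[of "Poly_Mapping.keys P"]
    by (induction P rule: frag_induction) (auto simp: single frag_extend_diff left_diff_distrib)
qed

text \<open>In the group ring \<open>frag_of u\<close> is the monomial with exponent
  \<open>u\<close>. This is the map induced by a change of exponents; it is a ring homomorphism once
  \<open>h\<close> is additive.\<close>

definition push :: "('a \<Rightarrow> 'b) \<Rightarrow> ('a \<Rightarrow>\<^sub>0 int) \<Rightarrow> ('b \<Rightarrow>\<^sub>0 int)" where
  "push h = frag_extend (\<lambda>u. frag_of (h u))"

lemma push_add: "push h (P + Q) = push h P + push h Q"
  by (simp add: push_def frag_extend_add)

lemma push_sum: "push h (\<Sum>i\<in>I. f i) = (\<Sum>i\<in>I. push h (f i))"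
  by (induction I rule: infinite_finite_induct) (simp_all add: push_add, simp_all add: push_def)

lemma push_single: "push h (Poly_Mapping.single u k) = Poly_Mapping.single (h u) k"
  by (metis cmul_frag_of frag_extend_cmul frag_extend_of push_def)

lemma push_mult:
  fixes h :: "'a::monoid_add \<Rightarrow> 'b::monoid_add"
  assumes "\<And>u v. h (u + v) = h u + h v"
  shows "push h (P * Q) = push h P * push h Q"
  unfolding push_def by (rule frag_extend_mult) (simp add: assms mult_single)

lemma push_power:
  fixes h :: "'a::monoid_add \<Rightarrow> 'b::monoid_add"
  assumes "\<And>u v. h (u + v) = h u + h v" "h 0 = 0"
  shows "push h (P ^ k) = push h P ^ k"
proof (induction k)
  case 0
  then show ?case
    using push_single[of h 0 1] by (simp add: assms(2))
qed (simp add: push_mult assms(1))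

text \<open>Only exponents sent to 0 contribute to the new constant term. The kernel condition
  concerns just the exponents that occur, so that it covers a map with trivial kernel only on
  vectors supported in a basis.\<close>

lemma constant_term_push:
  fixes h :: "'a::monoid_add \<Rightarrow> 'b::monoid_add"
  assumes "h 0 = 0" "\<And>u. u \<in> Poly_Mapping.keys P \<Longrightarrow> h u = 0 \<Longrightarrow> u = 0"
  shows "Poly_Mapping.lookup (push h P) 0 = Poly_Mapping.lookup P 0"
proof -
  have "Poly_Mapping.lookup (push h P) 0 =
      (\<Sum>u\<in>Poly_Mapping.keys P. Poly_Mapping.lookup P u * (if 0 = h u then 1 else 0))"
    by (simp add: push_def frag_extend_def lookup_sum)
  also have "\<dots> = (\<Sum>u\<in>Poly_Mapping.keys P. if u = 0 then Poly_Mapping.lookup P u else 0)"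
    using assms by (intro sum.cong refl) (metis mult.right_neutral mult_zero_right)
  also have "\<dots> = Poly_Mapping.lookup P 0"
    unfolding sum.delta[OF finite_keys] by (metis in_keys_iff)
  finally show ?thesis .
qed

section \<open>Grading by the exponent of one variable\<close>

definition homogeneous :: "'i \<Rightarrow> int \<Rightarrow> 'i laurent \<Rightarrow> bool" where
  "homogeneous e n P \<longleftrightarrow> (\<forall>u\<in>Poly_Mapping.keys P. Poly_Mapping.lookup u e = n)"

lemma homogeneous_add: "homogeneous e n P \<Longrightarrow> homogeneous e n Q \<Longrightarrow> homogeneous e n (P + Q)"
  using keys_add[of P Q] by (auto simp: homogeneous_def)

lemma homogeneous_sum: "(\<And>i. i \<in> I \<Longrightarrow> homogeneous e n (P i)) \<Longrightarrow> homogeneous e n (\<Sum>i\<in>I. P i)"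
  by (induction I rule: infinite_finite_induct) (auto simp: homogeneous_add, auto simp: homogeneous_def)

lemma homogeneous_mult:
  "homogeneous e m P \<Longrightarrow> homogeneous e n Q \<Longrightarrow> homogeneous e (m + n) (P * Q)"
  using keys_mult[of P Q] by (fastforce simp: homogeneous_def lookup_add)

lemma homogeneous_power: "homogeneous e m P \<Longrightarrow> homogeneous e (int k * m) (P ^ k)"
proof (induction k)
  case (Suc k)
  then show ?case
    using homogeneous_mult[of e m P "int k * m" "P ^ k"] by (simp add: algebra_simps)
qed (simp add: homogeneous_def)

lemma homogeneous_var_power: "homogeneous e (if i = e then k else 0) (var_power i k)"
  by (simp add: homogeneous_def var_power_def)

lemma homogeneous_of_nat: "homogeneous e 0 (of_nat n)"
  by (auto simp: homogeneous_def in_keys_iff lookup_of_nat when_def split: if_splits)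

lemma constant_term_homogeneous:
  "homogeneous e n P \<Longrightarrow> n \<noteq> 0 \<Longrightarrow> Poly_Mapping.lookup P 0 = 0"
  by (metis homogeneous_def in_keys_iff lookup_zero)

text \<open>In the expansion of the power only the terms containing \<open>X ^ i * Y ^ i\<close> have degree 0 in the variable \<open>e\<close>.\<close>

lemma constant_term_power_mutation:
  assumes "homogeneous e 1 X" "homogeneous e (-1) Y" "homogeneous e 1 X'" "homogeneous e (-1) Y'"
    and R: "homogeneous e 0 R" and XY: "X * Y = X' * Y'"
  shows "Poly_Mapping.lookup ((X + Y + R) ^ k) 0 = Poly_Mapping.lookup ((X' + Y' + R) ^ k) 0"
proof -
  \<comment> \<open>Two nested binomial expansions: first \<open>R\<close> is split off, then
    \<open>X\<close> from \<open>Y\<close>.\<close>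
  have expand: "(X + Y + R) ^ k =
    (\<Sum>m\<le>k. \<Sum>i\<le>m. of_nat (k choose m) * of_nat (m choose i) * (X ^ i * Y ^ (m - i) * R ^ (k - m)))"
    for X Y :: "'a laurent"
    unfolding binomial_ring[of "X + Y" R k] binomial_ring[of X Y]
    by (simp only: sum_distrib_left sum_distrib_right mult.assoc)
  have off: "Poly_Mapping.lookup (of_nat c * of_nat d * (X ^ i * Y ^ j * R ^ l)) 0 = 0"
    if "i \<noteq> j" and X: "homogeneous e 1 X" and Y: "homogeneous e (-1) Y" for X Y i j l and c d :: nat
  proof (rule constant_term_homogeneous)
    \<comment> \<open>The degree is \<open>i - j\<close>, written in the shape in which the rules
      for products and powers assemble it.\<close>
    show "homogeneous e (0 + 0 + (int i * 1 + int j * (-1) + int l * 0))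
        (of_nat c * of_nat d * (X ^ i * Y ^ j * R ^ l))"
      by (intro homogeneous_mult homogeneous_of_nat homogeneous_power X Y R)
  qed (use that(1) in simp)
  have "Poly_Mapping.lookup (of_nat c * of_nat d * (X ^ i * Y ^ j * R ^ l)) 0 =
        Poly_Mapping.lookup (of_nat c * of_nat d * (X' ^ i * Y' ^ j * R ^ l)) 0" for i j l and c d :: nat
  proof (cases "i = j")
    case True
    then have "X ^ i * Y ^ j = X' ^ i * Y' ^ j"
      using XY by (simp only: power_mult_distrib[symmetric])
    then show ?thesis by simp
  next
    case False
    then show ?thesis by (simp add: off assms)
  qed
  then show ?thesis unfolding expand lookup_sum by simp
qed

section \<open>Vertex potentials and changes of the coloring\<close>


lemma var_power_mult: "var_power i k * var_power i l = var_power i (k + l)"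
  by (simp add: var_power_def mult_single frag_cmul_distrib)

lemma var_power_0: "var_power i 0 = 1"
  by (simp add: var_power_def)

lemma var_power_inverse: "var_power i 1 * var_power i (- 1) = 1"
  by (simp add: var_power_mult var_power_0)

text \<open>The analogue of the vertex potential for two half-edges: the sum over all signs with
  \<open>si + sj = \<epsilon>\<close>, solved for \<open>sj\<close>.\<close>

definition pair_potential :: "'e \<Rightarrow> 'e \<Rightarrow> bit \<Rightarrow> 'e laurent" where
  "pair_potential i j \<epsilon> =
     var_power i 1 * var_power j (bit_sign \<epsilon>) + var_power i (- 1) * var_power j (- bit_sign \<epsilon>)"

lemma sum_zero_triples:
  "{(si, sj, sk). si + sj + sk = (0::bit)} = {(0, 0, 0), (0, 1, 1), (1, 0, 1), (1, 1, 0)}"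
  "{(si, sj, sk). si + sj + sk = (1::bit)} = {(1, 1, 1), (1, 0, 0), (0, 1, 0), (0, 0, 1)}"
proof -
  have all_bit: "(\<forall>s::bit. P s) \<longleftrightarrow> P 0 \<and> P 1" for P
    by (metis bit.exhaust)
  show "{(si, sj, sk). si + sj + sk = (0::bit)} = {(0, 0, 0), (0, 1, 1), (1, 0, 1), (1, 1, 0)}"
    "{(si, sj, sk). si + sj + sk = (1::bit)} = {(1, 1, 1), (1, 0, 0), (0, 1, 0), (0, 0, 1)}"
    by (simp_all add: set_eq_iff all_bit)
qed

text \<open>Split by the sign at \<open>i\<close>: \<open>si = 0\<close> leaves the condition
  \<open>sj + sk = \<epsilon>\<close>, and \<open>si = 1\<close> leaves
  \<open>sj + sk = \<epsilon> + 1\<close>. For \<open>i = e\<close> this exhibits the coefficients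
  of the variable of \<open>e\<close> and of its inverse.\<close>

lemma triple_potential_pair:
  "triple_potential i j k \<epsilon> =
     var_power i 1 * pair_potential j k \<epsilon> + var_power i (- 1) * pair_potential j k (\<epsilon> + 1)"
  by (cases \<epsilon> rule: bit.exhaust)
    (simp_all only: triple_potential_def sum_zero_triples,
     simp_all add: pair_potential_def bit_sign_def algebra_simps)

lemma pair_potential_commute: "pair_potential i j \<epsilon> = pair_potential j i \<epsilon>"
  by (cases \<epsilon> rule: bit.exhaust) (simp_all add: pair_potential_def bit_sign_def algebra_simps)

lemma triple_potential_swap23: "triple_potential i j k \<epsilon> = triple_potential i k j \<epsilon>"
  by (simp add: triple_potential_pair pair_potential_commute)

lemma triple_potential_swap12: "triple_potential i j k \<epsilon> = triple_potential j i k \<epsilon>"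
  by (cases \<epsilon> rule: bit.exhaust)
    (simp_all add: triple_potential_pair pair_potential_def bit_sign_def algebra_simps)

text \<open>The two transpositions generate all permutations of the half-edges. This makes the
  arbitrary order chosen by \<open>SOME\<close> in \<open>vertex_potential\<close> harmless.\<close>

lemma triple_potential_cong:
  assumes "{#i, j, k#} = {#i', j', k'#}"
  shows "triple_potential i j k \<epsilon> = triple_potential i' j' k' \<epsilon>"
proof -
  have "(i = i' \<and> {#j, k#} = {#j', k'#}) \<or> (i = j' \<and> {#j, k#} = {#i', k'#}) \<or>
      (i = k' \<and> {#j, k#} = {#i', j'#})"
    using assms by (auto simp: add_eq_conv_ex)
  then show ?thesis
    by (auto simp: add_eq_conv_ex)
      (metis triple_potential_swap12 triple_potential_swap23)+
qed

lemma vertex_potential_eq: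
  assumes "half_edges_at \<gamma> v = {#i, j, k#}"
  shows "vertex_potential \<gamma> col v = triple_potential i j k (col v)"
proof -
  have "case (SOME (i, j, k). half_edges_at \<gamma> v = {#i, j, k#}) of
      (i, j, k) \<Rightarrow> half_edges_at \<gamma> v = {#i, j, k#}"
    by (rule someI[of _ "(i, j, k)"]) (simp add: assms)
  then show ?thesis
    unfolding vertex_potential_def Let_def
    by (auto split: prod.splits intro!: triple_potential_cong simp: assms)
qed

lemma trivalent_half_edges:
  assumes "trivalent_graph \<gamma>" "v \<in> verts \<gamma>"
  obtains i j k where "half_edges_at \<gamma> v = {#i, j, k#}"
proof -
  have "size (half_edges_at \<gamma> v) = 3"
    using assms by (simp add: trivalent_graph_def)
  then obtain i M where M: "half_edges_at \<gamma> v = add_mset i M" "size M = 2"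
    using size_eq_Suc_imp_eq_union[of "half_edges_at \<gamma> v" 2] by auto
  then obtain j N where N: "M = add_mset j N" "size N = 1"
    using size_eq_Suc_imp_eq_union[of M 1] by auto
  then obtain k where "N = {#k#}"
    using size_1_singleton_mset by blast
  then show thesis using that M(1) N(1) by simp
qed

lemma count_half_edges_at:
  assumes "finite (edges \<gamma>)"
  shows "count (half_edges_at \<gamma> v) e = (if e \<in> edges \<gamma> then count (ends \<gamma> e) v else 0)"
  unfolding half_edges_at_def by (simp add: count_sum assms)

lemma keys_triple_potential:
  assumes "u \<in> Poly_Mapping.keys (triple_potential i j k \<epsilon>)"
  obtains p q r where "p \<in> {1, -1}" "q \<in> {1, -1}" "r \<in> {1, -1}"
    "u = frag_cmul p (frag_of i) + frag_cmul q (frag_of j) + frag_cmul r (frag_of k)"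
proof -
  from subsetD[OF keys_sum assms[unfolded triple_potential_def]] obtain s where
    "u \<in> Poly_Mapping.keys (case s of (si, sj, sk) \<Rightarrow>
      var_power i (bit_sign si) * var_power j (bit_sign sj) * var_power k (bit_sign sk))"
    by (rule UN_E)
  then obtain si sj sk where
    "u \<in> Poly_Mapping.keys
      (var_power i (bit_sign si) * var_power j (bit_sign sj) * var_power k (bit_sign sk))"
    by (cases s) simp
  then have "u = frag_cmul (bit_sign si) (frag_of i) + frag_cmul (bit_sign sj) (frag_of j) +
      frag_cmul (bit_sign sk) (frag_of k)"
    by (simp add: var_power_def mult_single)
  moreover have "bit_sign t \<in> {1, -1}" for t
    by (simp add: bit_sign_def)
  ultimately show thesis
    by (intro that)
qed

section \<open>Changes of the coloring by a boundary\<close>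

lemma sum_mult_multiplicity:
  fixes z :: "'e \<Rightarrow> 'r::comm_semiring_1"
  shows "(\<Sum>e\<in>E. z e * of_nat (n e)) = \<Sum>\<^sub># (image_mset z (\<Sum>e\<in>E. replicate_mset (n e) e))"
  by (induction E rule: infinite_finite_induct) (auto simp: mult.commute)

text \<open>Weighting edges by their incidence with \<open>v\<close> is the same as summing over
  half-edges. A loop enters twice and cancels in characteristic 2.\<close>

lemma chain_boundary_eq:
  assumes "finite (edges \<gamma>)" "half_edges_at \<gamma> v = {#i, j, k#}"
  shows "chain_boundary \<gamma> z v = z i + z j + z k"
proof -
  have "chain_boundary \<gamma> z v = \<Sum>\<^sub># (image_mset z (half_edges_at \<gamma> v))"
    by (simp only: chain_boundary_def half_edges_at_def sum_mult_multiplicity)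
  then show ?thesis
    by (simp only: assms(2) image_mset_add_mset sum_mset.add_mset image_mset_empty sum_mset.empty
        add_0_right add.assoc)
qed

text \<open>The effect on exponents of inverting the variables of the edges in the chain
  \<open>z\<close>.\<close>

definition flip_edges :: "('e \<Rightarrow> bit) \<Rightarrow> ('e \<Rightarrow>\<^sub>0 int) \<Rightarrow> ('e \<Rightarrow>\<^sub>0 int)" where
  "flip_edges z = frag_extend (\<lambda>e. frag_cmul (bit_sign (z e)) (frag_of e))"

lemma flip_edges_add: "flip_edges z (u + v) = flip_edges z u + flip_edges z v"
  by (simp add: flip_edges_def frag_extend_add)

lemma flip_edges_zero: "flip_edges z 0 = 0"
  by (simp add: flip_edges_def)

lemma bit_sign_square: "bit_sign s * bit_sign s = 1"
  by (simp add: bit_sign_def)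

lemma flip_edges_involution: "flip_edges z (flip_edges z u) = u"
  using subset_UNIV
  by (induction u rule: frag_induction)
    (simp_all add: flip_edges_def frag_extend_diff frag_extend_cmul bit_sign_square)

lemma push_flip_var_power:
  "push (flip_edges z) (var_power i k) = var_power i (bit_sign (z i) * k)"
  by (simp add: var_power_def push_single flip_edges_def frag_extend_cmul mult.commute)

text \<open>Inverting the variable of \<open>i\<close> replaces \<open>si\<close> by
  \<open>si + z i\<close> in the sum, which shifts the prescribed total of the signs. All sixteen
  cases are computed.\<close>

lemma push_flip_triple_potential:
  "push (flip_edges z) (triple_potential i j k \<epsilon>) = triple_potential i j k (\<epsilon> + (z i + z j + z k))"
  by (cases "z i" rule: bit.exhaust; cases "z j" rule: bit.exhaust; cases "z k" rule: bit.exhaust;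
      cases \<epsilon> rule: bit.exhaust)
    (simp_all add: triple_potential_pair pair_potential_def push_add push_mult flip_edges_add
      push_flip_var_power bit_sign_def algebra_simps)

lemma period_series_boundary_change:
  assumes "boundary_change (\<gamma>, c) (\<gamma>', c')"
  shows "period_series (graph_potential \<gamma> c) = period_series (graph_potential \<gamma>' c')"
proof -
  from assms obtain z where tri: "trivalent_graph \<gamma>" and [simp]: "\<gamma>' = \<gamma>"
    and z: "\<And>v. v \<in> verts \<gamma> \<Longrightarrow> c' v = c v + chain_boundary \<gamma> z v"
    unfolding boundary_change_def by auto
  have fin: "finite (edges \<gamma>)" using tri by (simp add: trivalent_graph_def)
  have "vertex_potential \<gamma> c' v = push (flip_edges z) (vertex_potential \<gamma> c v)" if v: "v \<in> verts \<gamma>" for v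
  proof -
    obtain i j k where h: "half_edges_at \<gamma> v = {#i, j, k#}"
      using trivalent_half_edges[OF tri v] .
    show ?thesis
      by (simp add: vertex_potential_eq[OF h] push_flip_triple_potential z[OF v] chain_boundary_eq[OF fin h])
  qed
  then have "graph_potential \<gamma> c' = push (flip_edges z) (graph_potential \<gamma> c)"
    by (simp add: graph_potential_def push_sum)
  \<comment> \<open>An involution is injective, so \<open>flip_edges z\<close> sends only 0 to
    0.\<close>
  then have "Poly_Mapping.lookup (graph_potential \<gamma> c' ^ k) 0 = Poly_Mapping.lookup (graph_potential \<gamma> c ^ k) 0" for k
    using constant_term_push[of "flip_edges z" "graph_potential \<gamma> c ^ k"]
    by (metis push_power flip_edges_add flip_edges_zero flip_edges_involution)
  then show ?thesis by (simp add: period_series_def)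
qed

section \<open>The identity behind elementary transformations\<close>

lemma mutation_identity:
  fixes a a' :: "'r::comm_ring_1"
  assumes "a * a' = 1" "b * b' = 1" "c * c' = 1" "d * d' = 1"
  shows "(a * b + a' * b' + (c * d + c' * d')) * (a * b' + a' * b + (c * d' + c' * d)) =
         (a * c + a' * c' + (b * d + b' * d')) * (a * c' + a' * c + (b * d' + b' * d))"
proof -
  \<comment> \<open>Primes denote inverses. What remains after cancellation are the squares of the
    variables and of their inverses, and all products of one factor from each pair with an odd
    number of inverses; this is symmetric in the four variables.\<close>
  have expand: "(a * b + a' * b' + (c * d + c' * d')) * (a * b' + a' * b + (c * d' + c' * d)) =
      (a * a + a' * a') + (b * b + b' * b') + (c * c + c' * c') + (d * d + d' * d') +
      (a * b * c * d' + a * b * c' * d + a' * b' * c * d' + a' * b' * c' * d +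
       a * b' * c * d + a' * b * c * d + a * b' * c' * d' + a' * b * c' * d')"
    if "a * a' = 1" "b * b' = 1" "c * c' = 1" "d * d' = 1" for a a' b b' c c' d d' :: 'r
  proof -
    have "(a * b + a' * b' + (c * d + c' * d')) * (a * b' + a' * b + (c * d' + c' * d)) =
      (a * a + a' * a') * (b * b') + (b * b + b' * b') * (a * a') +
      (c * c + c' * c') * (d * d') + (d * d + d' * d') * (c * c') +
      (a * b * c * d' + a * b * c' * d + a' * b' * c * d' + a' * b' * c' * d +
       a * b' * c * d + a' * b * c * d + a * b' * c' * d' + a' * b * c' * d')"
      by (simp add: algebra_simps)
    then show ?thesis by (simp add: that)
  qed
  show ?thesis
    \<comment> \<open>The second instance is the same expansion with \<open>b\<close> and
      \<open>c\<close> exchanged.\<close>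
    unfolding expand[OF assms] expand[OF assms(1,3,2,4)] by (simp add: algebra_simps)
qed

text \<open>The two factors are the coefficients of the variable of \<open>e\<close> and of its
  inverse, each collected from both endpoints of \<open>e\<close>. The edges \<open>b\<close> and
  \<open>c\<close> change places, while the colors stay at their vertices.\<close>

lemma pair_potential_mutation:
  "(pair_potential a b \<epsilon> + pair_potential c d \<delta>) * (pair_potential a b (\<epsilon> + 1) + pair_potential c d (\<delta> + 1)) =
   (pair_potential a c \<epsilon> + pair_potential b d \<delta>) * (pair_potential a c (\<epsilon> + 1) + pair_potential b d (\<delta> + 1))"
proof -
  note inv = var_power_inverse
  have inv': "var_power i (- 1) * var_power i 1 = 1" for i :: 'a
    by (simp add: var_power_mult var_power_0)
  have fold:
    "var_power i 1 * var_power j 1 + var_power i (- 1) * var_power j (- 1) = pair_potential i j 0"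
    "var_power i (- 1) * var_power j (- 1) + var_power i 1 * var_power j 1 = pair_potential i j 0"
    "var_power i 1 * var_power j (- 1) + var_power i (- 1) * var_power j 1 = pair_potential i j 1"
    "var_power i (- 1) * var_power j 1 + var_power i 1 * var_power j (- 1) = pair_potential i j 1" for i j :: 'a
    by (simp_all add: pair_potential_def bit_sign_def)
  \<comment> \<open>Changing one of the two colors inverts one of the four variables in the identity.\<close>
  note mutation =
    mutation_identity[OF inv[of a] inv[of b] inv[of c] inv[of d], unfolded fold]
    mutation_identity[OF inv[of a] inv[of b] inv[of c] inv'[of d], unfolded fold]
    mutation_identity[OF inv'[of a] inv[of b] inv[of c] inv[of d], unfolded fold]
  have bits: "(0::bit) + 1 = 1" "(1::bit) + 1 = 0"
    by simp_all
  show ?thesis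
  proof (cases \<epsilon> rule: bit.exhaust; cases \<delta> rule: bit.exhaust)
    \<comment> \<open>This is the case of two colors 0 with the two factors interchanged.\<close>
    assume "\<epsilon> = 1" "\<delta> = 1"
    then show ?thesis using mutation(1) by (simp only: bits mult.commute)
  qed (simp_all only: bits mutation)
qed

section \<open>Elementary transformations and sublattices\<close>


lemma homogeneous_pair_potential:
  assumes "i \<noteq> e" "j \<noteq> e"
  shows "homogeneous e 0 (pair_potential i j \<epsilon>)"
proof -
  have "homogeneous e (0 + 0) (var_power i k * var_power j l)" for k l
    using homogeneous_mult[OF homogeneous_var_power[of e i k] homogeneous_var_power[of e j l]] assms
    by simp
  then show ?thesis
    unfolding pair_potential_def by (simp add: homogeneous_add)
qed

lemma homogeneous_var_power_mult:
  assumes "homogeneous e 0 P"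
  shows "homogeneous e k (var_power e k * P)"
  using homogeneous_mult[OF homogeneous_var_power[of e e k] assms] by simp

lemma homogeneous_triple_potential:
  assumes "i \<noteq> e" "j \<noteq> e" "k \<noteq> e"
  shows "homogeneous e 0 (triple_potential i j k \<epsilon>)"
proof -
  have "homogeneous e (0 + 0) (var_power i l * pair_potential j k \<delta>)" for l \<delta>
    using homogeneous_mult[OF homogeneous_var_power[of e i l] homogeneous_pair_potential[OF assms(2,3)]]
      assms(1) by simp
  then show ?thesis
    unfolding triple_potential_pair by (simp add: homogeneous_add)
qed

text \<open>Only the half-edges at the two vertices enter, so the decomposition applies to the graph
  before and after the transformation.\<close>

lemma graph_potential_edge:
  assumes "finite (verts \<gamma>)" "v1 \<in> verts \<gamma>" "v2 \<in> verts \<gamma>" "v1 \<noteq> v2"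
    and h1: "half_edges_at \<gamma> v1 = {#e, a, b#}" and h2: "half_edges_at \<gamma> v2 = {#e, c, d#}"
  shows "graph_potential \<gamma> col =
      var_power e 1 * (pair_potential a b (col v1) + pair_potential c d (col v2)) +
      var_power e (- 1) * (pair_potential a b (col v1 + 1) + pair_potential c d (col v2 + 1)) +
      (\<Sum>v\<in>verts \<gamma> - {v1, v2}. vertex_potential \<gamma> col v)"
proof -
  have "graph_potential \<gamma> col = (\<Sum>v\<in>{v1, v2}. vertex_potential \<gamma> col v) +
      (\<Sum>v\<in>verts \<gamma> - {v1, v2}. vertex_potential \<gamma> col v)"
    unfolding graph_potential_def using assms(1-3) by (subst sum.subset_diff[of "{v1, v2}"]) (auto simp: add_ac)
  then show ?thesis
    using assms(4) by (simp add: vertex_potential_eq[OF h1] vertex_potential_eq[OF h2]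
        triple_potential_pair distrib_left add_ac)
qed

lemma period_series_elementary_transformation:
  assumes "elementary_transformation (\<gamma>, col) (\<gamma>', col')"
  shows "period_series (graph_potential \<gamma> col) = period_series (graph_potential \<gamma>' col')"
proof -
  from assms obtain e v1 v2 a b c d where
    tri: "trivalent_graph \<gamma>" and
    verts: "verts \<gamma>' = verts \<gamma>" and col: "\<And>v. v \<in> verts \<gamma> \<Longrightarrow> col' v = col v" and
    e: "e \<in> edges \<gamma>" and v: "v1 \<in> verts \<gamma>" "v2 \<in> verts \<gamma>" "v1 \<noteq> v2" and
    ends: "ends \<gamma> e = {#v1, v2#}" and
    h: "half_edges_at \<gamma> v1 = {#e, a, b#}" "half_edges_at \<gamma> v2 = {#e, c, d#}" and
    h': "half_edges_at \<gamma>' v1 = {#e, a, c#}" "half_edges_at \<gamma>' v2 = {#e, b, d#}" and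
    rest: "\<And>v. v \<in> verts \<gamma> - {v1, v2} \<Longrightarrow> half_edges_at \<gamma>' v = half_edges_at \<gamma> v"
    unfolding elementary_transformation_def by auto
  have fin: "finite (edges \<gamma>)" "finite (verts \<gamma>)"
    using tri by (simp_all add: trivalent_graph_def)
  \<comment> \<open>One half-edge of \<open>e\<close> is at \<open>v1\<close> and the other at
    \<open>v2\<close>. Hence \<open>e\<close> differs from \<open>a\<close>, \<open>b\<close>,
    \<open>c\<close>, \<open>d\<close> and does not occur at any other vertex.\<close>
  have count: "count (half_edges_at \<gamma> w) e = count {#v1, v2#} w" for w
    using count_half_edges_at[OF fin(1), of w e] e ends by simp
  have ab: "a \<noteq> e" "b \<noteq> e"
    using count[of v1] v(3) by (auto simp: h(1) split: if_splits)
  have cd: "c \<noteq> e" "d \<noteq> e"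
    using count[of v2] v(3) by (auto simp: h(2) split: if_splits)
  define R where "R = (\<Sum>v\<in>verts \<gamma> - {v1, v2}. vertex_potential \<gamma> col v)"
  \<comment> \<open>A vertex potential depends only on the half-edges and the color at its vertex,
    so both graphs share the remainder.\<close>
  have R': "R = (\<Sum>v\<in>verts \<gamma>' - {v1, v2}. vertex_potential \<gamma>' col' v)"
    unfolding R_def verts by (rule sum.cong) (simp_all add: vertex_potential_def rest col)
  have R: "homogeneous e 0 R"
    unfolding R_def
  proof (rule homogeneous_sum)
    fix w assume w: "w \<in> verts \<gamma> - {v1, v2}"
    then obtain i j k where ijk: "half_edges_at \<gamma> w = {#i, j, k#}"
      using trivalent_half_edges[OF tri, of w] by blast
    have "i \<noteq> e" "j \<noteq> e" "k \<noteq> e"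
      using count[of w] w by (auto simp: ijk split: if_splits)
    then show "homogeneous e 0 (vertex_potential \<gamma> col w)"
      by (simp add: vertex_potential_eq[OF ijk] homogeneous_triple_potential)
  qed
  have cancel: "(var_power e 1 * P) * (var_power e (- 1) * Q) = P * Q" for P Q
  proof -
    have "(var_power e 1 * P) * (var_power e (- 1) * Q) = (var_power e 1 * var_power e (- 1)) * (P * Q)"
      by (simp only: mult_ac)
    then show ?thesis by (simp add: var_power_inverse)
  qed
  have col12: "col' v1 = col v1" "col' v2 = col v2"
    using col v by simp_all
  have "Poly_Mapping.lookup (graph_potential \<gamma> col ^ k) 0 =
      Poly_Mapping.lookup (graph_potential \<gamma>' col' ^ k) 0" for k
    unfolding graph_potential_edge[OF fin(2) v h] R_def[symmetric]
      graph_potential_edge[OF fin(2)[folded verts] v(1)[folded verts] v(2)[folded verts] v(3) h'] R'[symmetric] col12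
    \<comment> \<open>The goals are the degrees of the five summands and the equality of the two
      products, which \<open>cancel\<close> reduces to
      \<open>pair_potential_mutation\<close>.\<close>
    by (rule constant_term_power_mutation[where e = e];
        (intro homogeneous_var_power_mult homogeneous_add homogeneous_pair_potential ab cd R
        | simp only: cancel pair_potential_mutation))
  then show ?thesis by (simp add: period_series_def)
qed

section \<open>Passing to a basis of the sublattice\<close>

definition supported :: "'i set \<Rightarrow> 'i laurent \<Rightarrow> bool" where
  "supported I W \<longleftrightarrow> (\<forall>u\<in>Poly_Mapping.keys W. Poly_Mapping.keys u \<subseteq> I)"

lemma supported_mult:
  assumes "supported I P" "supported I Q"
  shows "supported I (P * Q)"
  unfolding supported_def
proof
  fix u assume "u \<in> Poly_Mapping.keys (P * Q)"
  then obtain p q where "u = p + q" "p \<in> Poly_Mapping.keys P" "q \<in> Poly_Mapping.keys Q"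
    using keys_mult[of P Q] by blast
  then show "Poly_Mapping.keys u \<subseteq> I"
    using assms keys_add[of p q] unfolding supported_def by fast
qed

lemma supported_power: "supported I P \<Longrightarrow> supported I (P ^ k)"
  by (induction k) (auto simp: supported_mult, simp add: supported_def)

text \<open>\<open>frag_extend id\<close> evaluates a formal combination of lattice vectors.
  Independence of \<open>B\<close> says that its kernel is trivial on combinations supported in
  \<open>B\<close>.\<close>

lemma frag_extend_id_eq_0:
  fixes u :: "('i \<Rightarrow>\<^sub>0 int) \<Rightarrow>\<^sub>0 int"
  assumes "\<not> lattice.dependent B" "Poly_Mapping.keys u \<subseteq> B" "frag_extend id u = 0"
  shows "u = 0"
proof (rule poly_mapping_eqI)
  fix b
  have "Poly_Mapping.lookup u b = 0" if "b \<in> Poly_Mapping.keys u"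
    using lattice.independentD[OF assms(1) finite_keys assms(2), of "Poly_Mapping.lookup u"] that assms(3)
    by (simp add: frag_extend_def)
  then show "Poly_Mapping.lookup u b = Poly_Mapping.lookup 0 b"
    using in_keys_iff[of b u] by (metis lookup_zero)
qed

lemma lookup_representation:
  "Poly_Mapping.lookup (Abs_poly_mapping (lattice.representation B u)) = lattice.representation B u"
  by (rule lookup_Abs_poly_mapping) (rule lattice.finite_representation)

lemma keys_representation:
  "Poly_Mapping.keys (Abs_poly_mapping (lattice.representation B u)) \<subseteq> B"
proof
  fix b assume "b \<in> Poly_Mapping.keys (Abs_poly_mapping (lattice.representation B u))"
  then show "b \<in> B"
    unfolding in_keys_iff lookup_representation by (rule lattice.representation_ne_zero)
qed

lemma supported_in_basis: "supported B (in_basis B W)"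
  unfolding supported_def
proof
  fix u assume "u \<in> Poly_Mapping.keys (in_basis B W)"
  then obtain w where
    "u \<in> Poly_Mapping.keys (Poly_Mapping.single (Abs_poly_mapping (lattice.representation B w))
      (Poly_Mapping.lookup W w))"
    unfolding in_basis_def by (rule UN_E[OF subsetD[OF keys_sum]])
  then have "u = Abs_poly_mapping (lattice.representation B w)"
    unfolding keys_single by (simp split: if_splits)
  then show "Poly_Mapping.keys u \<subseteq> B"
    using keys_representation by simp
qed

lemma frag_extend_id_representation:
  assumes "\<not> lattice.dependent B" "finite B" "u \<in> lattice.span B"
  shows "frag_extend id (Abs_poly_mapping (lattice.representation B u)) = u"
proof -
  have "frag_extend id (Abs_poly_mapping (lattice.representation B u)) =
      (\<Sum>b\<in>B. frag_cmul (lattice.representation B u b) b)"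
    unfolding frag_extend_def lookup_representation id_apply
    using keys_representation assms(2)
    by (intro sum.mono_neutral_left) (auto simp: in_keys_iff lookup_representation)
  then show ?thesis
    using lattice.sum_representation_eq[OF assms(1,3,2)] by simp
qed

text \<open>Turning coordinates back into vectors recovers \<open>W\<close>. Working with this
  inverse direction avoids proving that \<open>in_basis\<close> is multiplicative, as
  \<open>push\<close> respects powers already.\<close>

lemma push_in_basis:
  assumes "\<not> lattice.dependent B" "finite B" "Poly_Mapping.keys W \<subseteq> lattice.span B"
  shows "push (frag_extend id) (in_basis B W) = W"
proof -
  have "push (frag_extend id) (in_basis B W) =
      (\<Sum>u\<in>Poly_Mapping.keys W. frag_cmul (Poly_Mapping.lookup W u) (frag_of u))"
    unfolding in_basis_def push_sum push_single cmul_frag_of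
    using assms by (intro sum.cong) (auto simp: frag_extend_id_representation)
  then show ?thesis
    using frag_expansion[of W] by (simp add: frag_extend_def)
qed

text \<open>The powers of \<open>in_basis B W\<close> only have exponents supported in
  \<open>B\<close>, where the evaluation map has trivial kernel; hence constant terms survive
  it.\<close>

lemma period_series_in_basis:
  assumes "\<not> lattice.dependent B" "finite B" "Poly_Mapping.keys W \<subseteq> lattice.span B"
  shows "period_series (in_basis B W) = period_series W"
proof -
  have "Poly_Mapping.lookup (W ^ k) 0 = Poly_Mapping.lookup (in_basis B W ^ k) 0" for k
  proof -
    have "W ^ k = push (frag_extend id) (in_basis B W ^ k)"
      by (simp add: push_power frag_extend_add push_in_basis[OF assms])
    then show ?thesis
      using supported_power[OF supported_in_basis, of B W k] frag_extend_id_eq_0[OF assms(1)]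
      by (simp add: constant_term_push supported_def)
  qed
  then show ?thesis by (simp add: period_series_def)
qed

text \<open>Every exponent is one of the generators of the lattice. The first claim permits
  coordinates in a lattice basis, the second integration over the torus indexed by the
  edges.\<close>

lemma keys_graph_potential:
  assumes "trivalent_graph \<gamma>"
  shows "Poly_Mapping.keys (graph_potential \<gamma> col) \<subseteq> potential_lattice \<gamma>"
    and "supported (edges \<gamma>) (graph_potential \<gamma> col)"
proof -
  have *: "u \<in> potential_lattice \<gamma> \<and> Poly_Mapping.keys u \<subseteq> edges \<gamma>"
    if "u \<in> Poly_Mapping.keys (graph_potential \<gamma> col)" for u
  proof -
    from subsetD[OF keys_sum that[unfolded graph_potential_def]]
    obtain v where v: "v \<in> verts \<gamma>" "u \<in> Poly_Mapping.keys (vertex_potential \<gamma> col v)"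
      by (rule UN_E)
    obtain i j k where h: "half_edges_at \<gamma> v = {#i, j, k#}"
      using trivalent_half_edges[OF assms v(1)] .
    obtain p q r where pqr: "p \<in> {1, -1}" "q \<in> {1, -1}" "r \<in> {1, -1}" and
      u: "u = frag_cmul p (frag_of i) + frag_cmul q (frag_of j) + frag_cmul r (frag_of k)"
      using keys_triple_potential[OF v(2)[unfolded vertex_potential_eq[OF h]]] .
    have fin: "finite (edges \<gamma>)" using assms by (simp add: trivalent_graph_def)
    have "set_mset (half_edges_at \<gamma> v) \<subseteq> edges \<gamma>"
      using count_half_edges_at[OF fin, of v] by (metis count_eq_zero_iff subsetI)
    then have "i \<in> edges \<gamma>" "j \<in> edges \<gamma>" "k \<in> edges \<gamma>"
      by (simp_all add: h)
    then have "Poly_Mapping.keys u \<subseteq> edges \<gamma>"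
      unfolding u cmul_frag_of
      by (intro order_trans[OF keys_add] Un_least) simp_all
    moreover have "u \<in> potential_lattice \<gamma>"
      unfolding potential_lattice_def using v(1) h pqr u
      by (intro lattice.span_base) blast
    ultimately show ?thesis by simp
  qed
  show "Poly_Mapping.keys (graph_potential \<gamma> col) \<subseteq> potential_lattice \<gamma>"
    using * by blast
  show "supported (edges \<gamma>) (graph_potential \<gamma> col)"
    using * unfolding supported_def by blast
qed

section \<open>Invariance under the generated equivalence relation\<close>

lemma period_series_related:
  assumes "related_colored_graphs (\<gamma>, c) (\<gamma>', c')"
  shows "period_series (graph_potential \<gamma> c) = period_series (graph_potential \<gamma>' c')"
proof -
  have "period_series (case_prod graph_potential G) = period_series (case_prod graph_potential G')"
    if "equivclp (\<lambda>G G'. elementary_transformation G G' \<or> boundary_change G G') G G'" for G G' :: "('a, 'b) colored_graph"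
    using that
  proof (induction rule: equivclp_induct)
    case (step y z)
    obtain \<gamma> c \<gamma>' c' where "y = (\<gamma>, c)" "z = (\<gamma>', c')" by fastforce
    with step show ?case
      \<comment> \<open>The symmetric closure allows a step in either direction, so each move is
        used both ways.\<close>
      using period_series_elementary_transformation[of \<gamma> c \<gamma>' c'] period_series_elementary_transformation[of \<gamma>' c' \<gamma> c]
        period_series_boundary_change[of \<gamma> c \<gamma>' c'] period_series_boundary_change[of \<gamma>' c' \<gamma> c]
      by auto
  qed simp
  from this[OF assms[unfolded related_colored_graphs_def]] show ?thesis by simp
qed

section \<open>Periods as power series\<close>


definition monomial_eval :: "('i \<Rightarrow> complex) \<Rightarrow> ('i \<Rightarrow>\<^sub>0 int) \<Rightarrow> complex" where
  "monomial_eval x u = (\<Prod>i\<in>Poly_Mapping.keys u. x i powi Poly_Mapping.lookup u i)"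

lemma monomial_eval_superset:
  assumes "finite I" "Poly_Mapping.keys u \<subseteq> I"
  shows "monomial_eval x u = (\<Prod>i\<in>I. x i powi Poly_Mapping.lookup u i)"
  unfolding monomial_eval_def
  by (rule prod.mono_neutral_left) (use assms in \<open>auto simp: not_in_keys_iff_lookup_eq_zero\<close>)

text \<open>Exponents may cancel in \<open>u + v\<close>, so all products are taken over the union
  of the supports.\<close>

lemma monomial_eval_add:
  assumes "\<And>i. x i \<noteq> 0"
  shows "monomial_eval x (u + v) = monomial_eval x u * monomial_eval x v"
proof -
  let ?I = "Poly_Mapping.keys u \<union> Poly_Mapping.keys v"
  have "monomial_eval x (u + v) = (\<Prod>i\<in>?I. x i powi Poly_Mapping.lookup (u + v) i)"
    by (rule monomial_eval_superset) (simp_all add: keys_add)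
  also have "\<dots> = (\<Prod>i\<in>?I. x i powi Poly_Mapping.lookup u i) * (\<Prod>i\<in>?I. x i powi Poly_Mapping.lookup v i)"
    by (simp add: lookup_add power_int_add assms prod.distrib)
  also have "\<dots> = monomial_eval x u * monomial_eval x v"
    by (simp add: monomial_eval_superset[of ?I])
  finally show ?thesis .
qed

lemma laurent_eval_superset:
  assumes "finite S" "Poly_Mapping.keys W \<subseteq> S"
  shows "laurent_eval W x = (\<Sum>u\<in>S. of_int (Poly_Mapping.lookup W u) * monomial_eval x u)"
  unfolding laurent_eval_def monomial_eval_def
  by (rule sum.mono_neutral_left) (use assms in \<open>auto simp: not_in_keys_iff_lookup_eq_zero\<close>)

lemma laurent_eval_diff: "laurent_eval (P - Q) x = laurent_eval P x - laurent_eval Q x"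
proof -
  let ?S = "Poly_Mapping.keys P \<union> Poly_Mapping.keys Q"
  have "laurent_eval (P - Q) x =
      (\<Sum>u\<in>?S. of_int (Poly_Mapping.lookup (P - Q) u) * monomial_eval x u)"
    by (rule laurent_eval_superset) (simp_all add: keys_diff)
  also have "\<dots> = (\<Sum>u\<in>?S. of_int (Poly_Mapping.lookup P u) * monomial_eval x u) -
      (\<Sum>u\<in>?S. of_int (Poly_Mapping.lookup Q u) * monomial_eval x u)"
    by (simp add: lookup_minus left_diff_distrib sum_subtractf)
  also have "\<dots> = laurent_eval P x - laurent_eval Q x"
    by (simp add: laurent_eval_superset[of ?S])
  finally show ?thesis .
qed

lemma laurent_eval_frag_of: "laurent_eval (frag_of u) x = monomial_eval x u"
  by (simp add: laurent_eval_def monomial_eval_def)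

lemma laurent_eval_0: "laurent_eval 0 x = 0"
  by (simp add: laurent_eval_def)

lemma laurent_eval_mult:
  assumes "\<And>i. x i \<noteq> 0"
  shows "laurent_eval (P * Q) x = laurent_eval P x * laurent_eval Q x"
proof -
  have single: "laurent_eval (frag_of u * Q) x = monomial_eval x u * laurent_eval Q x" for u
    using subset_UNIV
    by (induction Q rule: frag_induction)
      (auto simp: mult_single monomial_eval_add[OF assms] right_diff_distrib laurent_eval_diff
        laurent_eval_frag_of laurent_eval_0)
  show ?thesis
    using subset_UNIV[of "Poly_Mapping.keys P"]
    by (induction P rule: frag_induction)
      (auto simp: single left_diff_distrib laurent_eval_diff laurent_eval_frag_of laurent_eval_0)
qed

lemma laurent_eval_power:
  assumes "\<And>i. x i \<noteq> 0"
  shows "laurent_eval (P ^ k) x = laurent_eval P x ^ k"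
proof (induction k)
  case 0
  show ?case
    using laurent_eval_frag_of[of 0 x] by (simp add: monomial_eval_def)
qed (simp add: laurent_eval_mult[OF assms])

text \<open>Monomials have absolute value 1 on the torus. The bound is independent of the point and
  makes the geometric series converge uniformly for small \<open>t\<close>.\<close>

lemma norm_laurent_eval_cis:
  "norm (laurent_eval W (\<lambda>i. cis (\<theta> i))) \<le>
    (\<Sum>u\<in>Poly_Mapping.keys W. \<bar>of_int (Poly_Mapping.lookup W u)\<bar>)"
  unfolding laurent_eval_def
  by (rule sum_norm_le) (simp add: norm_mult prod_norm[symmetric] norm_power_int)

section \<open>Integrals over the torus\<close>

lemma has_bochner_integral_cis:
  "has_bochner_integral lborel (\<lambda>t. indicator {0..2 * pi} t *\<^sub>R (cis t powi n))
    (if n = 0 then 2 * complex_of_real pi else 0)"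
proof (cases "n = 0")
  case True
  have "has_bochner_integral lborel (\<lambda>t. indicator {0..2 * pi} t *\<^sub>R (1::complex))
      (of_real (2 * pi) - of_real 0)"
    by (rule has_bochner_integral_FTC_Icc) (auto intro!: derivative_eq_intros)
  then show ?thesis using True by simp
next
  case False
  \<comment> \<open>For \<open>n\<close> nonzero the integrand has a periodic antiderivative, so the
    values at the two ends cancel.\<close>
  have "has_bochner_integral lborel (\<lambda>t. indicator {0..2 * pi} t *\<^sub>R cis (of_int n * t))
      (cis (of_int n * (2 * pi)) / (\<i> * of_int n) - cis (of_int n * 0) / (\<i> * of_int n))"
  proof (rule has_bochner_integral_FTC_Icc)
    fix t
    show "((\<lambda>t. cis (of_int n * t) / (\<i> * of_int n)) has_vector_derivative cis (of_int n * t))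
        (at t within {0..2 * pi})"
      unfolding has_vector_derivative_def
      using False by (auto intro!: derivative_eq_intros simp: scaleR_conv_of_real field_simps)
  qed (auto intro!: continuous_intros)
  moreover have "cis (of_int n * (2 * pi)) = 1"
    using cis_multiple_2pi[of "of_int n"] by (simp add: mult_ac)
  ultimately show ?thesis
    using False by (simp add: cis_power_int)
qed

text \<open>Membership in \<open>PiE\<close> also demands extensionality, which the coordinate
  factors cannot detect; points of the product space have it.\<close>

lemma indicator_PiE_eq_prod:
  fixes A :: "'i \<Rightarrow> 'a set"
  assumes "finite I" "\<theta> \<in> extensional I"
  shows "indicator (\<Pi>\<^sub>E i\<in>I. A i) \<theta> = (\<Prod>i\<in>I. indicator (A i) (\<theta> i) :: real)"
proof (cases "\<theta> \<in> (\<Pi>\<^sub>E i\<in>I. A i)")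
  case False
  then obtain i where "i \<in> I" "\<theta> i \<notin> A i"
    using assms(2) by (auto simp: PiE_def)
  then have "(\<Prod>i\<in>I. indicator (A i) (\<theta> i) :: real) = 0"
    using assms(1) by (intro prod_zero bexI[of _ i]) simp_all
  then show ?thesis using False by simp
next
  case True
  then have "(\<Prod>i\<in>I. indicator (A i) (\<theta> i) :: real) = 1"
    by (intro prod.neutral) (simp add: PiE_mem)
  then show ?thesis using True by simp
qed

text \<open>By Fubini the integral is a product of integrals over circles, and a variable with
  nonzero exponent contributes the factor 0.\<close>

lemma has_bochner_integral_torus_monomial:
  assumes "finite I" "Poly_Mapping.keys u \<subseteq> I"
  shows "has_bochner_integral (\<Pi>\<^sub>M i\<in>I. lborel)
    (\<lambda>\<theta>. indicator (\<Pi>\<^sub>E i\<in>I. {0..2 * pi}) \<theta> *\<^sub>R monomial_eval (\<lambda>i. cis (\<theta> i)) u)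
    (if u = 0 then (2 * complex_of_real pi) ^ card I else 0)"
proof -
  interpret product_sigma_finite "\<lambda>_::'a. lborel :: real measure"
    by unfold_locales
  define f where "f i t = indicator {0..2 * pi} t *\<^sub>R (cis t powi Poly_Mapping.lookup u i)" for i t
  have f: "integrable lborel (f i)"
    "integral\<^sup>L lborel (f i) = (if Poly_Mapping.lookup u i = 0 then 2 * complex_of_real pi else 0)" for i
    using has_bochner_integral_cis[of "Poly_Mapping.lookup u i"]
    unfolding f_def has_bochner_integral_iff by simp_all
  have "integral\<^sup>L (\<Pi>\<^sub>M i\<in>I. lborel) (\<lambda>\<theta>. \<Prod>i\<in>I. f i (\<theta> i)) =
      (\<Prod>i\<in>I. if Poly_Mapping.lookup u i = 0 then 2 * complex_of_real pi else 0)"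
    by (subst product_integral_prod) (simp_all add: assms(1) f)
  also have "\<dots> = (if u = 0 then (2 * complex_of_real pi) ^ card I else 0)"
  proof (cases "u = 0")
    case False
    then obtain i where "i \<in> Poly_Mapping.keys u"
      using keys_eq_empty by blast
    then show ?thesis
      using False assms by (auto intro!: prod_zero bexI[of _ i])
  qed simp
  finally have "has_bochner_integral (\<Pi>\<^sub>M i\<in>I. lborel) (\<lambda>\<theta>. \<Prod>i\<in>I. f i (\<theta> i))
      (if u = 0 then (2 * complex_of_real pi) ^ card I else 0)"
    unfolding has_bochner_integral_iff using product_integrable_prod[of I f] f(1) assms(1) by blast
  \<comment> \<open>The two integrands are compared only on the space of the product measure, where
    points are extensional.\<close>
  moreover have "indicator (\<Pi>\<^sub>E i\<in>I. {0..2 * pi}) \<theta> *\<^sub>R monomial_eval (\<lambda>i. cis (\<theta> i)) u =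
      (\<Prod>i\<in>I. f i (\<theta> i))" if "\<theta> \<in> space (Pi\<^sub>M I (\<lambda>_. lborel))" for \<theta>
  proof -
    have ext: "\<theta> \<in> extensional I"
      using that by (simp add: space_PiM PiE_def)
    show ?thesis
      unfolding indicator_PiE_eq_prod[OF assms(1) ext] monomial_eval_superset[OF assms]
        f_def scaleR_conv_of_real of_real_prod prod.distrib by (rule refl)
  qed
  ultimately show ?thesis
    using has_bochner_integral_cong[OF refl] by (metis (no_types, lifting))
qed

lemma has_bochner_integral_torus_laurent:
  assumes "finite I" "supported I W"
  shows "has_bochner_integral (\<Pi>\<^sub>M i\<in>I. lborel)
    (\<lambda>\<theta>. indicator (\<Pi>\<^sub>E i\<in>I. {0..2 * pi}) \<theta> *\<^sub>R laurent_eval W (\<lambda>i. cis (\<theta> i)))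
    (of_int (Poly_Mapping.lookup W 0) * (2 * complex_of_real pi) ^ card I)"
proof -
  have "has_bochner_integral (\<Pi>\<^sub>M i\<in>I. lborel)
    (\<lambda>\<theta>. \<Sum>u\<in>Poly_Mapping.keys W. of_int (Poly_Mapping.lookup W u) *
      (indicator (\<Pi>\<^sub>E i\<in>I. {0..2 * pi}) \<theta> *\<^sub>R monomial_eval (\<lambda>i. cis (\<theta> i)) u))
    (\<Sum>u\<in>Poly_Mapping.keys W. of_int (Poly_Mapping.lookup W u) *
      (if u = 0 then (2 * complex_of_real pi) ^ card I else 0))"
    using assms unfolding supported_def
    by (intro has_bochner_integral_sum has_bochner_integral_mult_right has_bochner_integral_torus_monomial) auto
  moreover have "(\<Sum>u\<in>Poly_Mapping.keys W. of_int (Poly_Mapping.lookup W u) *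
      (if u = 0 then (2 * complex_of_real pi) ^ card I else 0)) =
      of_int (Poly_Mapping.lookup W 0) * (2 * complex_of_real pi) ^ card I"
    by (simp add: if_distrib not_in_keys_iff_lookup_eq_zero cong: if_cong)
  ultimately show ?thesis
    by (simp add: laurent_eval_superset[OF finite_keys order_refl] scaleR_sum_right)
qed

text \<open>The condition on \<open>t\<close> bounds the modulus of \<open>t * L \<theta>\<close> by
  a constant below 1, which justifies integrating the geometric series termwise.\<close>

lemma period_sums:
  assumes "finite I" "supported I W"
    and t: "norm t * (\<Sum>u\<in>Poly_Mapping.keys W. \<bar>of_int (Poly_Mapping.lookup W u)\<bar>) < 1"
  shows "(\<lambda>k. of_int (fps_nth (period_series W) k) * t ^ k) sums period I W t"
proof -
  define M :: real where "M = (\<Sum>u\<in>Poly_Mapping.keys W. \<bar>of_int (Poly_Mapping.lookup W u)\<bar>)"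
  define L where "L \<theta> = laurent_eval W (\<lambda>i. cis (\<theta> i))" for \<theta> :: "'a \<Rightarrow> real"
  define A where "A = (\<Pi>\<^sub>E i\<in>I. {0..2 * pi})"
  let ?M = "Pi\<^sub>M I (\<lambda>_. lborel :: real measure)"
  define f where "f k \<theta> = t ^ k * (indicator A \<theta> *\<^sub>R L \<theta> ^ k)" for k \<theta>
  have M0: "0 \<le> M" unfolding M_def by (rule sum_nonneg) simp
  have f: "has_bochner_integral ?M (f k)
      (t ^ k * (of_int (fps_nth (period_series W) k) * (2 * complex_of_real pi) ^ card I))" for k
    unfolding f_def A_def L_def
    using has_bochner_integral_torus_laurent[OF assms(1) supported_power[OF assms(2), of k]]
    by (intro has_bochner_integral_mult_right) (simp add: laurent_eval_power period_series_def)
  have tL: "norm (t * L \<theta>) \<le> norm t * M" for \<theta>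
    unfolding norm_mult L_def M_def by (intro mult_left_mono norm_laurent_eval_cis) simp
  have bound: "norm (f k \<theta>) \<le> (norm t * M) ^ k * indicator A \<theta>" for k \<theta>
    using power_mono[OF tL[of \<theta>] norm_ge_zero, of k]
    by (simp add: f_def indicator_def norm_mult norm_power power_mult_distrib)
  have geometric: "summable (\<lambda>k. (norm t * M) ^ k)"
    using t M0 unfolding M_def[symmetric] by (intro summable_geometric) simp
  have A: "integrable ?M (indicator A :: _ \<Rightarrow> real)"
  proof -
    \<comment> \<open>The term for \<open>k = 0\<close> is the indicator itself, so its
      integrability comes from \<open>f\<close>.\<close>
    have "f 0 = (\<lambda>\<theta>. of_real (indicator A \<theta>))"
      by (simp add: f_def scaleR_conv_of_real fun_eq_iff)
    then have "integrable ?M (\<lambda>\<theta>. Re (of_real (indicator A \<theta>)))"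
      using f[of 0] unfolding has_bochner_integral_iff by (intro integrable_Re) simp
    then show ?thesis by simp
  qed
  \<comment> \<open>The exchange needs summable norms at each point and summable integrals of norms;
    both are dominated by the same geometric series.\<close>
  have "(\<lambda>k. integral\<^sup>L ?M (f k)) sums (\<integral>\<theta>. (suminf (\<lambda>k. f k \<theta>)) \<partial>?M)"
  proof (rule sums_integral)
    show "integrable ?M (f k)" for k
      using f unfolding has_bochner_integral_iff by blast
    show "AE \<theta> in ?M. summable (\<lambda>k. norm (f k \<theta>))"
    proof (rule AE_I2)
      show "summable (\<lambda>k. norm (f k \<theta>))" for \<theta>
        using bound
        by (intro summable_comparison_test'[OF summable_mult2[OF geometric, of "indicator A \<theta>"], of 0]) simp
    qed
    show "summable (\<lambda>k. \<integral>\<theta>. norm (f k \<theta>) \<partial>?M)"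
    proof (rule summable_comparison_test'[OF summable_mult2[OF geometric, of "\<integral>\<theta>. indicator A \<theta> \<partial>?M"], of 0])
      fix k
      have "(\<integral>\<theta>. norm (f k \<theta>) \<partial>?M) \<le> (\<integral>\<theta>. (norm t * M) ^ k * indicator A \<theta> \<partial>?M)"
        using f A bound unfolding has_bochner_integral_iff
        by (intro integral_mono integrable_norm integrable_mult_right) auto
      then show "norm (\<integral>\<theta>. norm (f k \<theta>) \<partial>?M) \<le> (norm t * M) ^ k * (\<integral>\<theta>. indicator A \<theta> \<partial>?M)"
        by simp
    qed
  qed
  moreover have "suminf (\<lambda>k. f k \<theta>) = indicator A \<theta> *\<^sub>R (1 / (1 - t * L \<theta>))" for \<theta>
  proof -
    have "norm (t * L \<theta>) < 1"
      using tL[of \<theta>] t unfolding M_def[symmetric] by linarith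
    then have "(\<lambda>k. indicator A \<theta> *\<^sub>R (t * L \<theta>) ^ k) sums (indicator A \<theta> *\<^sub>R (1 / (1 - t * L \<theta>)))"
      by (intro sums_scaleR_right geometric_sums)
    then show ?thesis
      by (intro sums_unique[symmetric]) (simp add: f_def power_mult_distrib)
  qed
  ultimately have "(\<lambda>k. t ^ k * (of_int (fps_nth (period_series W) k) * (2 * complex_of_real pi) ^ card I)) sums
      (\<integral>\<theta>. indicator A \<theta> *\<^sub>R (1 / (1 - t * L \<theta>)) \<partial>?M)"
    using f unfolding has_bochner_integral_iff by simp
  from sums_mult[OF this, of "(1 / (2 * complex_of_real pi)) ^ card I"]
  show ?thesis
    unfolding period_def set_lebesgue_integral_def A_def[symmetric] L_def[symmetric]
    by (simp add: power_divide power_one_over field_simps)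
qed

lemma eventually_period_eq:
  assumes "finite I" "supported I W" "finite J" "supported J V"
    and "period_series W = period_series V"
  shows "\<forall>\<^sub>F t in nhds 0. period I W t = period J V t"
proof -
  \<comment> \<open>Stated as a product, so that \<open>C = 0\<close> is no special case.\<close>
  have small: "\<forall>\<^sub>F t in nhds (0::complex). norm t * C < 1" for C :: real
  proof -
    have "((\<lambda>t::complex. norm t * C) \<longlongrightarrow> norm (0::complex) * C) (nhds 0)"
      by (intro tendsto_intros filterlim_ident)
    then show ?thesis by (rule order_tendstoD) simp
  qed
  show ?thesis
    using small[of "\<Sum>u\<in>Poly_Mapping.keys W. \<bar>of_int (Poly_Mapping.lookup W u)\<bar>"]
      small[of "\<Sum>u\<in>Poly_Mapping.keys V. \<bar>of_int (Poly_Mapping.lookup V u)\<bar>"]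
  proof eventually_elim
    case (elim t)
    show ?case
      using period_sums[OF assms(1,2) elim(1)] period_sums[OF assms(3,4) elim(2)]
      unfolding assms(5) by (rule sums_unique2)
  qed
qed

theorem corollary2p18:
  fixes \<gamma> \<gamma>' :: "('v, 'e) multigraph" and c c' :: "'v \<Rightarrow> bit"
  assumes "trivalent_graph \<gamma>" and "trivalent_graph \<gamma>'"
    and "related_colored_graphs (\<gamma>, c) (\<gamma>', c')"
  shows "(\<forall>\<^sub>F t in nhds 0.
            period (edges \<gamma>) (graph_potential \<gamma> c) t = period (edges \<gamma>') (graph_potential \<gamma>' c') t) \<and>
         period_series (graph_potential \<gamma> c) = period_series (graph_potential \<gamma>' c') \<and>
         (\<forall>B. lattice_basis B (potential_lattice \<gamma>) \<longrightarrow>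
            (\<forall>\<^sub>F t in nhds 0.
               period (edges \<gamma>) (graph_potential \<gamma> c) t =
               period B (in_basis B (graph_potential \<gamma> c)) t) \<and>
            period_series (graph_potential \<gamma> c) =
            period_series (in_basis B (graph_potential \<gamma> c)))"
proof (intro conjI allI impI)
  have fin: "finite (edges \<gamma>)" "finite (edges \<gamma>')"
    using assms(1,2) by (simp_all add: trivalent_graph_def)
  note supp = keys_graph_potential(2)[OF assms(1)] keys_graph_potential(2)[OF assms(2)]
  show series: "period_series (graph_potential \<gamma> c) = period_series (graph_potential \<gamma>' c')"
    by (rule period_series_related[OF assms(3)])
  show "\<forall>\<^sub>F t in nhds 0.
      period (edges \<gamma>) (graph_potential \<gamma> c) t = period (edges \<gamma>') (graph_potential \<gamma>' c') t"
    by (rule eventually_period_eq[OF fin(1) supp(1) fin(2) supp(2) series])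
  fix B assume "lattice_basis B (potential_lattice \<gamma>)"
  then have B: "\<not> lattice.dependent B" "finite B" "lattice.span B = potential_lattice \<gamma>"
    by (simp_all add: lattice_basis_def)
  show lattice: "period_series (graph_potential \<gamma> c) = period_series (in_basis B (graph_potential \<gamma> c))"
    using period_series_in_basis[OF B(1,2)] keys_graph_potential(1)[OF assms(1)] B(3) by simp
  show "\<forall>\<^sub>F t in nhds 0.
      period (edges \<gamma>) (graph_potential \<gamma> c) t = period B (in_basis B (graph_potential \<gamma> c)) t"
    by (rule eventually_period_eq[OF fin(1) supp(1) B(2) supported_in_basis lattice])
qed

end
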